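(* Let $n\ge 1$, let $M=\{1^{k_1},2^{k_2},\ldots,n^{k_n}\}$ be a multiset with $k_i\ge 1$ for all $i$, and let $K=k_1+k_2+\cdots+k_n$. For $0\le i\le K-n$ and $1\le j\le\lfloor (K+1-i)/2\rfloor$, $$\gamma_{M,i,j}=\bigl|\{\sigma\in Q_M \mid \mathrm{plat}(\sigma)=i,\ \mathrm{des}(\sigma)=j,\ \mathrm{dfall}(\sigma)=0\}\bigr|,$$ where $\gamma_{M,i,j}$ are the partial $\gamma$-coefficients of the Eulerian polynomial $C_M(x,y,z)$.
   Context: Here $i^{k_i}$ means $k_i$ occurrences of $i$. A permutation $\sigma=\sigma_1\sigma_2\cdots\sigma_K$ of the multiset $M$ is a Stirling permutation if whenever $\sigma_a=\sigma_b$ with $a<b$, one has $\sigma_c\ge\sigma_a$ for all $a<c<b$. $Q_M$ is the set of Stirling permutations of $M$. Convention: $\sigma_0=\sigma_{K+1}=0$. An index $1\le i\le K$ is an ascent if $\sigma_{i-1}<\sigma_i$, a descent if $\sigma_i>\sigma_{i+1}$, and a plateau if $\sigma_i=\sigma_{i+1}$; their numbers are $\mathrm{asc}(\sigma),\mathrm{des}(\sigma),\mathrm{plat}(\sigma)$. Define $$C_M(x,y,z)=\sum_{\sigma\in Q_M}x^{\mathrm{asc}(\sigma)}y^{\mathrm{des}(\sigma)}z^{\mathrm{plat}(\sigma)}.$$ The polynomial $C_M(x,y,z)$ is symmetric in $x$ and $y$, and its partial $\gamma$-coefficients $\gamma_{M,i,j}$ are the coefficients (uniquely) determined by the partial $\gamma$-expansion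 $$C_M(x,y,z)=\sum_{i=0}^{K-n} z^i\sum_{j=1}^{\lfloor (K+1-i)/2\rfloor}\gamma_{M,i,j}\,(xy)^j(x+y)^{K+1-i-2j}.$$ Double falls: let $i$ be a descent of $\sigma$ and let $\sigma_p$ be the first occurrence of the value $\sigma_i$ in $\sigma$ (so $p\le i$). Then $i$ is a double fall of $\sigma$ if $p-1$ is also a descent of $\sigma$, i.e. $\sigma_{p-1}>\sigma_p$ (which is impossible if $p=1$, since $\sigma_0=0$). $\mathrm{dfall}(\sigma)$ denotes the number of double falls of $\sigma$. *)

theory Defs
  imports
    "HOL-Combinatorics.Multiset_Permutations"
    "HOL-Computational_Algebra.Polynomial"
begin

text \<open>
  Words are lists, addressed with 1-based positions as in \<open>\<sigma>\<^sub>1 \<sigma>\<^sub>2 \<dots> \<sigma>\<^sub>K\<close>; all positions outside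
  \<open>{1..K}\<close> carry the value 0, which gives the convention \<open>\<sigma>\<^sub>0 = \<sigma>\<^bsub>K+1\<^esub> = 0\<close>.
\<close>

definition entry :: "nat list \<Rightarrow> nat \<Rightarrow> nat" where
  "entry \<sigma> i = (if 1 \<le> i \<and> i \<le> length \<sigma> then \<sigma> ! (i - 1) else 0)"

definition stirling :: "nat list \<Rightarrow> bool" where
  "stirling \<sigma> \<longleftrightarrow>
     (\<forall>a b. 1 \<le> a \<and> a < b \<and> b \<le> length \<sigma> \<and> entry \<sigma> a = entry \<sigma> b \<longrightarrow>
        (\<forall>c. a < c \<and> c < b \<longrightarrow> entry \<sigma> c \<ge> entry \<sigma> a))"

definition stirling_permutations :: "nat multiset \<Rightarrow> nat list set" where
  "stirling_permutations M = {\<sigma> \<in> permutations_of_multiset M. stirling \<sigma>}"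

definition is_ascent :: "nat list \<Rightarrow> nat \<Rightarrow> bool" where
  "is_ascent \<sigma> i \<longleftrightarrow> 1 \<le> i \<and> i \<le> length \<sigma> \<and> entry \<sigma> (i - 1) < entry \<sigma> i"

definition is_descent :: "nat list \<Rightarrow> nat \<Rightarrow> bool" where
  "is_descent \<sigma> i \<longleftrightarrow> 1 \<le> i \<and> i \<le> length \<sigma> \<and> entry \<sigma> i > entry \<sigma> (i + 1)"

definition is_plateau :: "nat list \<Rightarrow> nat \<Rightarrow> bool" where
  "is_plateau \<sigma> i \<longleftrightarrow> 1 \<le> i \<and> i \<le> length \<sigma> \<and> entry \<sigma> i = entry \<sigma> (i + 1)"

definition asc :: "nat list \<Rightarrow> nat" where
  "asc \<sigma> = card {i. is_ascent \<sigma> i}"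

definition des :: "nat list \<Rightarrow> nat" where
  "des \<sigma> = card {i. is_descent \<sigma> i}"

definition plat :: "nat list \<Rightarrow> nat" where
  "plat \<sigma> = card {i. is_plateau \<sigma> i}"

definition first_occurrence :: "nat list \<Rightarrow> nat \<Rightarrow> nat" where
  "first_occurrence \<sigma> v = (LEAST p. 1 \<le> p \<and> p \<le> length \<sigma> \<and> entry \<sigma> p = v)"

text \<open>If the first occurrence is at position 1, then \<open>p - 1 = 0\<close> is not a descent.\<close>

definition is_double_fall :: "nat list \<Rightarrow> nat \<Rightarrow> bool" where
  "is_double_fall \<sigma> i \<longleftrightarrow>
     is_descent \<sigma> i \<and> is_descent \<sigma> (first_occurrence \<sigma> (entry \<sigma> i) - 1)"

definition dfall :: "nat list \<Rightarrow> nat" where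
  "dfall \<sigma> = card {i. is_double_fall \<sigma> i}"

text \<open>
  The polynomial ring \<open>\<int>[x,y,z]\<close> is represented as \<open>\<int>[x][y][z]\<close>, that is, \<open>z\<close> is the outermost
  indeterminate.
\<close>

type_synonym poly3 = "int poly poly poly"

definition var_x :: poly3 where "var_x = [:[:[:0, 1:]:]:]"
definition var_y :: poly3 where "var_y = [:[:0, 1:]:]"
definition var_z :: poly3 where "var_z = [:0, 1:]"

definition eulerian_poly :: "nat multiset \<Rightarrow> poly3" where
  "eulerian_poly M =
     (\<Sum>\<sigma>\<in>stirling_permutations M. var_x ^ asc \<sigma> * var_y ^ des \<sigma> * var_z ^ plat \<sigma>)"

text \<open>
  With \<open>K = size M\<close> and \<open>n = card (set_mset M)\<close>, the number of distinct values in \<open>M\<close>. The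
  coefficient family is set to 0 outside the index range of the expansion, where the expansion does
  not constrain it; this makes the family as a function unique.
\<close>

definition is_partial_gamma_expansion :: "nat multiset \<Rightarrow> (nat \<Rightarrow> nat \<Rightarrow> int) \<Rightarrow> bool" where
  "is_partial_gamma_expansion M g \<longleftrightarrow>
     (let K = size M; n = card (set_mset M) in
        eulerian_poly M =
          (\<Sum>i = 0..K - n. var_z ^ i *
             (\<Sum>j = 1..(K + 1 - i) div 2.
                of_int (g i j) * (var_x * var_y) ^ j * (var_x + var_y) ^ (K + 1 - i - 2 * j))) \<and>
        (\<forall>i j. \<not> (i \<le> K - n \<and> 1 \<le> j \<and> j \<le> (K + 1 - i) div 2) \<longrightarrow> g i j = 0))"

definition partial_gamma :: "nat multiset \<Rightarrow> nat \<Rightarrow> nat \<Rightarrow> int" where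
  "partial_gamma M = (THE g. is_partial_gamma_expansion M g)"

end

theory Submission
  imports Defs
begin

text \<open>
  In a Stirling permutation each value \<open>v\<close> has exactly one occurrence that can end an ascent, the
  first one, and exactly one that can start a descent, the last one. Let \<open>L\<close> be the set of values whose
  first occurrence ends an ascent and \<open>R\<close> the set of values whose last occurrence starts a descent.
  Then \<open>asc\<close> and \<open>des\<close> are the cardinalities of \<open>L\<close> and \<open>R\<close>, and a double fall is a value in \<open>R - L\<close>.
  Every monomial of the Eulerian polynomial is therefore determined by the profile \<open>(e, l, r)\<close>, the
  cardinalities of \<open>L \<inter> R\<close>, \<open>L - R\<close> and \<open>R - L\<close>: it is \<open>(xy)\<^sup>e x\<^sup>l y\<^sup>r z\<^sup>p\<close> with
  \<open>p = K + 1 - 2e - l - r\<close>.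

  The claim follows from a binomial law: the values in exactly one of \<open>L\<close> and \<open>R\<close> are distributed over
  \<open>L - R\<close> and \<open>R - L\<close> as if by tossing fair coins. That is, the number of Stirling
  permutations with profile \<open>(e, l, r)\<close> is \<open>l + r choose r\<close> times the number of those with profile
  \<open>(e, l + r, 0)\<close> (\<open>profile_count_binomial\<close>). Given this, the binomial theorem collects the terms \<open>x\<^sup>l y\<^sup>r\<close> with
  \<open>l + r = s\<close> into \<open>(x + y)\<^sup>s\<close>, one such power for each permutation without double falls
  (\<open>eulerian_poly_expansion\<close>).

  Instead of a group action that moves values between the two sides, an induction on the number of
  distinct values gives the binomial law. All copies of the largest value \<open>N\<close> are adjacent, so a
  permutation arises in exactly one way from one without \<open>N\<close> by inserting the block of \<open>N\<close>s into one of
  its gaps (\<open>stirling_permutations_add_max\<close>). The block puts \<open>N\<close> into \<open>L \<inter> R\<close>; filling an ascent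
  removes a value from \<open>L\<close>, filling a descent removes one from \<open>R\<close>, filling a plateau changes neither.
  On the generating function in indeterminates \<open>a, b, c, z\<close> for \<open>L \<inter> R\<close>, \<open>L - R\<close>, \<open>R - L\<close> and
  plateaus, an insertion of \<open>k\<close> copies acts as
  \<open>a z\<^bsup>k-1\<^esup> ((b + c) \<partial>\<^sub>a + \<partial>\<^sub>b + \<partial>\<^sub>c + \<partial>\<^sub>z)\<close>, and this operator preserves the functions of
  \<open>a, b + c, z\<close>. The binomial law states the same for coefficients, and \<open>binomial_recurrence\<close> is the
  corresponding calculation.

  The coefficients of the expansion are unique because \<open>(xy)\<^sup>j (x + y)\<^bsup>m-2j\<^esup>\<close> has lowest power \<open>j\<close>
  in \<open>y\<close> (\<open>gamma_basis_independent\<close>).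
\<close>

section \<open>Entries of words\<close>

lemma entry_pos: "0 < entry \<sigma> i \<Longrightarrow> 1 \<le> i \<and> i \<le> length \<sigma>"
  by (auto simp: entry_def split: if_splits)

lemma entry_in_set: "1 \<le> i \<Longrightarrow> i \<le> length \<sigma> \<Longrightarrow> entry \<sigma> i \<in> set \<sigma>"
  by (auto simp: entry_def)

lemma in_set_entry: "v \<in> set \<sigma> \<Longrightarrow> \<exists>i. 1 \<le> i \<and> i \<le> length \<sigma> \<and> entry \<sigma> i = v"
  by (metis One_nat_def Suc_leI diff_Suc_1 entry_def in_set_conv_nth le_add1 plus_1_eq_Suc)

lemma entry_eq_0_iff: "0 \<notin> set \<sigma> \<Longrightarrow> entry \<sigma> i = 0 \<longleftrightarrow> i = 0 \<or> length \<sigma> < i"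
  by (metis entry_in_set entry_def less_one linorder_not_less)

lemma entry_less:
  assumes "\<forall>v\<in>set \<sigma>. v < N" "0 < N"
  shows "entry \<sigma> i < N"
  using assms entry_in_set[of i \<sigma>] by (cases "1 \<le> i \<and> i \<le> length \<sigma>") (auto simp: entry_def)

text \<open>
  A position outside the word has entry 0, and entries between two zeros are at least 0 anyway.
\<close>

lemma stirlingD:
  "stirling \<sigma> \<Longrightarrow> entry \<sigma> a = entry \<sigma> b \<Longrightarrow> a < c \<Longrightarrow> c < b \<Longrightarrow> entry \<sigma> a \<le> entry \<sigma> c"
  unfolding stirling_def
  by (metis One_nat_def Suc_leI bot_nat_0.extremum entry_def less_trans not_le_imp_less)

section \<open>Stirling permutations grow by blocks of the largest value\<close>

text \<open>
  Gap \<open>t\<close> of a word of length \<open>K\<close>, for \<open>0 \<le> t \<le> K\<close>, lies between positions \<open>t\<close> and \<open>t + 1\<close>; the two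
  outer gaps border on the conventional entries 0.
\<close>

definition insert_block :: "nat \<Rightarrow> nat \<Rightarrow> nat \<Rightarrow> nat list \<Rightarrow> nat list" where
  "insert_block N k t \<sigma> = take t \<sigma> @ replicate k N @ drop t \<sigma>"

lemma entry_insert_block:
  assumes "t \<le> length \<sigma>"
  shows "entry (insert_block N k t \<sigma>) i =
    (if i \<le> t then entry \<sigma> i else if i \<le> t + k then N else entry \<sigma> (i - k))"
  using assms by (auto simp: entry_def insert_block_def nth_append min_def le_diff_conv)

text \<open>
  The positions outside the block correspond monotonically to those of the original word. The
  entries of the block are maximal, so they may stand between any two equal entries, and no other entry
  stands between two entries of the block.
\<close>

lemma stirling_insert_block:
  assumes less: "\<forall>v\<in>set \<sigma>. v < N" and t: "t \<le> length \<sigma>" and k: "0 < k"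
  shows "stirling (insert_block N k t \<sigma>) \<longleftrightarrow> stirling \<sigma>"
proof
  let ?\<tau> = "insert_block N k t \<sigma>"
  let ?\<phi> = "\<lambda>i. if i \<le> t then i else i + k"
  have \<phi>: "entry ?\<tau> (?\<phi> i) = entry \<sigma> i" for i
    using t by (auto simp: entry_insert_block)
  have mono: "i < j \<Longrightarrow> ?\<phi> i < ?\<phi> j" for i j
    by auto
  show "stirling \<sigma>" if st: "stirling ?\<tau>"
    unfolding stirling_def
  proof (intro allI impI)
    fix a b c
    assume "1 \<le> a \<and> a < b \<and> b \<le> length \<sigma> \<and> entry \<sigma> a = entry \<sigma> b" "a < c \<and> c < b"
    thus "entry \<sigma> a \<le> entry \<sigma> c"
      using stirlingD[OF st, of "?\<phi> a" "?\<phi> b" "?\<phi> c"] mono \<phi> by metis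
  qed
  show "stirling ?\<tau>" if st: "stirling \<sigma>"
    unfolding stirling_def
  proof (intro allI impI)
    fix a b c
    assume ab: "1 \<le> a \<and> a < b \<and> b \<le> length ?\<tau> \<and> entry ?\<tau> a = entry ?\<tau> b" and c: "a < c \<and> c < b"
    have len: "length ?\<tau> = length \<sigma> + k"
      using t by (simp add: insert_block_def)
    have N: "entry ?\<tau> i = N \<longleftrightarrow> t < i \<and> i \<le> t + k" if "1 \<le> i" "i \<le> length ?\<tau>" for i
      using that less entry_in_set[of i \<sigma>] entry_in_set[of "i - k" \<sigma>] t
      unfolding entry_insert_block[OF t] len by force
    have le: "entry ?\<tau> i \<le> N" if "1 \<le> i" "i \<le> length ?\<tau>" for i
      using that less entry_in_set[of i \<sigma>] entry_in_set[of "i - k" \<sigma>] t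
      unfolding entry_insert_block[OF t] len by (force intro: less_imp_le)
    let ?\<psi> = "\<lambda>i. if i \<le> t then i else i - k"
    show "entry ?\<tau> a \<le> entry ?\<tau> c"
    proof (cases "entry ?\<tau> c = N")
      case True
      thus ?thesis using le ab by simp
    next
      case False
      with N[of a] N[of b] N[of c] ab c
      have "\<not> (t < a \<and> a \<le> t + k)" "\<not> (t < b \<and> b \<le> t + k)" "\<not> (t < c \<and> c \<le> t + k)"
        by auto
      hence "entry ?\<tau> a = entry \<sigma> (?\<psi> a)" "entry ?\<tau> b = entry \<sigma> (?\<psi> b)"
        "entry ?\<tau> c = entry \<sigma> (?\<psi> c)" "?\<psi> a < ?\<psi> c" "?\<psi> c < ?\<psi> b"
        using c by (auto simp: entry_insert_block[OF t])
      thus ?thesis using stirlingD[OF st] ab by metis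
    qed
  qed
qed

lemma stirling_permutationsD:
  assumes "\<sigma> \<in> stirling_permutations M"
  shows "stirling \<sigma>" "length \<sigma> = size M" "set \<sigma> = set_mset M"
  using assms unfolding stirling_permutations_def permutations_of_multiset_def
  by (auto simp flip: size_mset)

text \<open>
  An entry between two copies of the maximum \<open>N\<close> must be at least \<open>N\<close>, hence equal to \<open>N\<close>, so the copies of
  \<open>N\<close> form one block. Deleting the block recovers the smaller permutation, and its first position
  recovers the gap.
\<close>

lemma stirling_permutations_add_max:
  assumes less: "\<forall>v\<in>#M. v < N" and k: "0 < k"
  shows "bij_betw (\<lambda>(\<sigma>, t). insert_block N k t \<sigma>) (stirling_permutations M \<times> {..size M})
    (stirling_permutations (M + replicate_mset k N))"
proof -
  note len = stirling_permutationsD(2) and in_M = stirling_permutationsD(3)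
  have left_inv: "(filter (\<lambda>v. v \<noteq> N) (insert_block N k t \<sigma>),
        length (takeWhile (\<lambda>v. v \<noteq> N) (insert_block N k t \<sigma>))) = (\<sigma>, t)"
    if \<sigma>: "\<sigma> \<in> stirling_permutations M" and t: "t \<le> size M" for \<sigma> t
  proof -
    have "N \<notin> set \<sigma>" using in_M[OF \<sigma>] less by auto
    hence *: "\<forall>v\<in>set (take t \<sigma>). v \<noteq> N" "\<forall>v\<in>set (drop t \<sigma>). v \<noteq> N"
      by (auto dest: in_set_takeD in_set_dropD)
    have "filter (\<lambda>v. v \<noteq> N) (take t \<sigma>) = take t \<sigma>" "filter (\<lambda>v. v \<noteq> N) (drop t \<sigma>) = drop t \<sigma>"
      using * by (simp_all only: filter_True)
    moreover have "takeWhile (\<lambda>v. v \<noteq> N) (insert_block N k t \<sigma>) = take t \<sigma>"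
      using * k by (cases k) (auto simp: insert_block_def takeWhile_append)
    ultimately show ?thesis
      using t len[OF \<sigma>] by (simp add: insert_block_def)
  qed
  have inj: "inj_on (\<lambda>(\<sigma>, t). insert_block N k t \<sigma>) (stirling_permutations M \<times> {..size M})"
    by (rule inj_on_inverseI[where g = "\<lambda>\<tau>. (filter (\<lambda>v. v \<noteq> N) \<tau>, length (takeWhile (\<lambda>v. v \<noteq> N) \<tau>))"])
       (use left_inv in auto)
  have into: "insert_block N k t \<sigma> \<in> stirling_permutations (M + replicate_mset k N)"
    if \<sigma>: "\<sigma> \<in> stirling_permutations M" and t: "t \<le> size M" for \<sigma> t
  proof -
    have "mset (insert_block N k t \<sigma>) = mset \<sigma> + replicate_mset k N"
      using arg_cong[OF append_take_drop_id[of t \<sigma>], of mset]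
      unfolding insert_block_def mset_append by (simp del: append_take_drop_id add: ac_simps)
    thus ?thesis
      using \<sigma> t stirling_insert_block[of \<sigma> N t k] less k len[OF \<sigma>] in_M[OF \<sigma>]
      by (simp add: stirling_permutations_def permutations_of_multiset_def)
  qed
  have onto: "\<exists>\<sigma> t. \<sigma> \<in> stirling_permutations M \<and> t \<le> size M \<and> \<tau> = insert_block N k t \<sigma>"
    if \<tau>: "\<tau> \<in> stirling_permutations (M + replicate_mset k N)" for \<tau>
  proof -
    have ms: "mset \<tau> = M + replicate_mset k N" and st: "stirling \<tau>"
      using \<tau> by (auto simp: stirling_permutations_def permutations_of_multiset_def)
    have "N \<in> set \<tau>"
      using arg_cong[OF ms, of set_mset] k by auto
    then obtain u w where \<tau>_eq: "\<tau> = u @ N # w" and Nu: "N \<notin> set u"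
      by (meson split_list_first)
    \<comment> \<open>\<open>v\<close> is the rest of the word after the run of \<open>N\<close>s that starts at the first \<open>N\<close>.\<close>
    define v where "v = dropWhile (\<lambda>v. v = N) w"
    obtain m where w: "w = replicate m N @ v"
      using takeWhile_dropWhile_id[of "\<lambda>v. v = N" w] replicate_length_same[of "takeWhile (\<lambda>v. v = N) w" N]
      unfolding v_def by (metis (full_types) set_takeWhileD)
    have Nv: "N \<notin> set v"
    proof
      assume "N \<in> set v"
      then obtain c v' where v: "v = c # v'" "c \<noteq> N" "N \<in> set v'"
        using hd_dropWhile[of "\<lambda>v. v = N" w] unfolding v_def[symmetric] by (cases v) auto
      then obtain r where r: "r < length v'" "v' ! r = N" by (meson in_set_conv_nth)
      let ?p = "length u + 1"
      have "entry \<tau> ?p = N" "entry \<tau> (?p + m + 1) = c" "entry \<tau> (?p + m + 2 + r) = N"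
        using r by (auto simp: entry_def \<tau>_eq w v nth_append)
      hence "N \<le> c" using stirlingD[OF st, of ?p "?p + m + 2 + r" "?p + m + 1"] by simp
      moreover have "c \<in># M + replicate_mset k N"
        unfolding ms[symmetric] \<tau>_eq w v by simp
      ultimately show False using less v(2) by (auto split: if_splits)
    qed
    have \<tau>_eq': "\<tau> = u @ replicate (Suc m) N @ v" by (simp add: \<tau>_eq w)
    have "N \<notin># M" using less by auto
    hence "count (mset \<tau>) N = k"
      unfolding ms by (simp add: not_in_iff)
    moreover have "count (mset \<tau>) N = Suc m"
      using Nu Nv by (simp add: \<tau>_eq' count_mset_0_iff)
    ultimately have m: "Suc m = k" by simp
    hence "mset (u @ v) = M"
      using ms unfolding \<tau>_eq' by (simp add: ac_simps)
    moreover have eq: "\<tau> = insert_block N k (length u) (u @ v)"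
      by (simp add: \<tau>_eq' insert_block_def m)
    moreover from calculation have "stirling (u @ v)"
      using st stirling_insert_block[of "u @ v" N "length u" k] less k
      by (metis le_add1 length_append set_mset_mset)
    ultimately show ?thesis
      by (intro exI[of _ "u @ v"] exI[of _ "length u"])
         (auto simp: stirling_permutations_def permutations_of_multiset_def simp flip: size_mset)
  qed
  show ?thesis
    unfolding bij_betw_def using inj into onto by (fast intro!: equalityI)
qed

section \<open>Values with a free left or right side\<close>

text \<open>
  The occurrences of a value \<open>v\<close> cut the stretch of entries \<open>\<ge> v\<close> around them into slots, in which larger
  values may stand. The leftmost slot of \<open>v\<close> is free iff the first occurrence of \<open>v\<close> ends an ascent, and
  the rightmost slot is free iff the last occurrence starts a descent. Sets of values, unlike sets of
  positions, do not shift when a block is inserted.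
\<close>

definition left_free :: "nat list \<Rightarrow> nat set" where
  "left_free \<sigma> = {v. \<exists>g. entry \<sigma> g < v \<and> entry \<sigma> (Suc g) = v}"

definition right_free :: "nat list \<Rightarrow> nat set" where
  "right_free \<sigma> = {v. \<exists>g. entry \<sigma> g = v \<and> entry \<sigma> (Suc g) < v}"

lemma left_free_subset: "left_free \<sigma> \<subseteq> set \<sigma>"
  by (auto simp: left_free_def intro!: entry_in_set dest: entry_pos[OF le_less_trans[OF le0]])

lemma right_free_subset: "right_free \<sigma> \<subseteq> set \<sigma>"
  by (auto simp: right_free_def intro!: entry_in_set dest: entry_pos[OF le_less_trans[OF le0]])

lemma finite_free [simp]: "finite (left_free \<sigma>)" "finite (right_free \<sigma>)"
  using left_free_subset right_free_subset by (meson List.finite_set finite_subset)+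

text \<open>
  If two ascents ended in the same value, the entry before the second one would be a smaller entry between
  two copies of that value.
\<close>

lemma bij_betw_ascents:
  assumes "stirling \<sigma>"
  shows "bij_betw (\<lambda>g. entry \<sigma> (Suc g)) {g. entry \<sigma> g < entry \<sigma> (Suc g)} (left_free \<sigma>)"
proof -
  have "entry \<sigma> (Suc g) \<noteq> entry \<sigma> (Suc h)"
    if "g < h" "entry \<sigma> g < entry \<sigma> (Suc g)" "entry \<sigma> h < entry \<sigma> (Suc h)" for g h
    using stirlingD[OF assms, of "Suc g" "Suc h" h] that by (cases "Suc g = h") auto
  hence "inj_on (\<lambda>g. entry \<sigma> (Suc g)) {g. entry \<sigma> g < entry \<sigma> (Suc g)}"
    by (metis (no_types, lifting) linorder_inj_onI' mem_Collect_eq)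
  thus ?thesis by (auto simp: bij_betw_def left_free_def)
qed

lemma bij_betw_descents:
  assumes "stirling \<sigma>"
  shows "bij_betw (entry \<sigma>) {g. entry \<sigma> (Suc g) < entry \<sigma> g} (right_free \<sigma>)"
proof -
  have "entry \<sigma> g \<noteq> entry \<sigma> h"
    if "g < h" "entry \<sigma> (Suc g) < entry \<sigma> g" "entry \<sigma> (Suc h) < entry \<sigma> h" for g h
    using stirlingD[OF assms, of g h "Suc g"] that by (cases "Suc g = h") auto
  hence "inj_on (entry \<sigma>) {g. entry \<sigma> (Suc g) < entry \<sigma> g}"
    by (metis (no_types, lifting) linorder_inj_onI' mem_Collect_eq)
  thus ?thesis by (auto simp: bij_betw_def right_free_def)
qed

lemma is_descent_iff: "is_descent \<sigma> i \<longleftrightarrow> entry \<sigma> (Suc i) < entry \<sigma> i"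
  using entry_pos[of \<sigma> i] by (auto simp: is_descent_def)

lemma asc_eq_card_left_free:
  assumes "stirling \<sigma>"
  shows "asc \<sigma> = card (left_free \<sigma>)"
proof -
  have "{i. is_ascent \<sigma> i} = Suc ` {g. entry \<sigma> g < entry \<sigma> (Suc g)}"
    by (auto simp: is_ascent_def image_iff gr0_conv_Suc Suc_le_eq dest: entry_pos[OF le_less_trans[OF le0]])
  thus ?thesis
    using bij_betw_same_card[OF bij_betw_ascents[OF assms]] by (simp add: asc_def card_image)
qed

lemma des_eq_card_right_free:
  assumes "stirling \<sigma>"
  shows "des \<sigma> = card (right_free \<sigma>)"
  using bij_betw_same_card[OF bij_betw_descents[OF assms]] by (simp add: des_def is_descent_iff)

lemma gap_le_length: "entry \<sigma> g \<noteq> entry \<sigma> (Suc g) \<Longrightarrow> g \<le> length \<sigma>"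
  using entry_pos[of \<sigma> g] entry_pos[of \<sigma> "Suc g"] by (cases "entry \<sigma> g = 0") auto

lemma gaps_partition:
  "{..length \<sigma>} = {g. entry \<sigma> g < entry \<sigma> (Suc g)} \<union> {g. entry \<sigma> (Suc g) < entry \<sigma> g}
    \<union> {g. g \<le> length \<sigma> \<and> entry \<sigma> g = entry \<sigma> (Suc g)}"
  using gap_le_length[of \<sigma>] linorder_less_linear by fastforce

lemma card_gaps:
  assumes "stirling \<sigma>"
  shows "card (left_free \<sigma>) + card (right_free \<sigma>) + card {g. g \<le> length \<sigma> \<and> entry \<sigma> g = entry \<sigma> (Suc g)}
    = Suc (length \<sigma>)"
proof -
  let ?A = "{g. entry \<sigma> g < entry \<sigma> (Suc g)}" and ?D = "{g. entry \<sigma> (Suc g) < entry \<sigma> g}"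
    and ?P = "{g. g \<le> length \<sigma> \<and> entry \<sigma> g = entry \<sigma> (Suc g)}"
  have "{..length \<sigma>} = ?A \<union> ?D \<union> ?P" by (rule gaps_partition)
  hence "Suc (length \<sigma>) = card (?A \<union> ?D \<union> ?P)" and "finite (?A \<union> ?D \<union> ?P)"
    by (metis card_atMost, metis finite_atMost)
  moreover have "card (?A \<union> ?D \<union> ?P) = card ?A + card ?D + card ?P"
    using \<open>finite (?A \<union> ?D \<union> ?P)\<close> by (subst card_Un_disjoint; (subst card_Un_disjoint)?; auto)
  ultimately show ?thesis
    using bij_betw_same_card[OF bij_betw_ascents[OF assms]]
      bij_betw_same_card[OF bij_betw_descents[OF assms]] by simp
qed

text \<open>
  For a nonempty word of positive entries the outer gaps are an ascent and a descent, so that the plateaus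
  among the gaps are the plateaus among the positions \<open>1, \<dots>, K\<close>.
\<close>

lemma asc_des_plat:
  assumes "stirling \<sigma>" "0 \<notin> set \<sigma>" "\<sigma> \<noteq> []"
  shows "asc \<sigma> + des \<sigma> + plat \<sigma> = Suc (length \<sigma>)"
proof -
  have "entry \<sigma> 0 = 0" "entry \<sigma> 1 \<noteq> 0"
    using assms by (auto simp: entry_eq_0_iff)
  hence "{i. is_plateau \<sigma> i} = {g. g \<le> length \<sigma> \<and> entry \<sigma> g = entry \<sigma> (Suc g)}"
    by (auto simp: is_plateau_def Suc_le_eq intro!: gr0I)
  thus ?thesis
    using card_gaps[OF assms(1)] asc_eq_card_left_free des_eq_card_right_free assms(1) by (simp add: plat_def)
qed

text \<open>
  The predecessor of the first occurrence of \<open>v\<close> differs from \<open>v\<close>; it is larger, that is, it starts a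
  descent, exactly when the left side of \<open>v\<close> is not free. Hence \<open>i\<close> is a double fall iff the right side of
  its value is free and the left side is not.
\<close>

lemma dfall_eq_card:
  assumes st: "stirling \<sigma>" and pos: "0 \<notin> set \<sigma>"
  shows "dfall \<sigma> = card (right_free \<sigma> - left_free \<sigma>)"
proof -
  have fall: "is_descent \<sigma> (first_occurrence \<sigma> v - 1) \<longleftrightarrow> v \<notin> left_free \<sigma>" if v: "v \<in> set \<sigma>" for v
  proof -
    define p where "p = first_occurrence \<sigma> v"
    have p: "1 \<le> p" "p \<le> length \<sigma>" "entry \<sigma> p = v"
      using LeastI_ex[OF in_set_entry[OF v]] unfolding p_def first_occurrence_def by auto
    have first: "entry \<sigma> q \<noteq> v" if "1 \<le> q" "q < p" for q
      using not_less_Least[of q "\<lambda>q. 1 \<le> q \<and> q \<le> length \<sigma> \<and> entry \<sigma> q = v"] that p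
      unfolding p_def first_occurrence_def by auto
    have vpos: "0 < v" using v pos by (metis gr0I)
    have "v \<in> left_free \<sigma> \<longleftrightarrow> entry \<sigma> (p - 1) < v"
    proof
      assume "entry \<sigma> (p - 1) < v"
      thus "v \<in> left_free \<sigma>" using p by (auto simp: left_free_def intro!: exI[of _ "p - 1"])
    next
      assume "v \<in> left_free \<sigma>"
      then obtain g where g: "entry \<sigma> g < v" "entry \<sigma> (Suc g) = v" by (auto simp: left_free_def)
      have "\<not> Suc g < p" using first[of "Suc g"] g by auto
      moreover have "\<not> p < Suc g"
        using stirlingD[OF st, of p "Suc g" g] p g by (cases "p = g") auto
      ultimately show "entry \<sigma> (p - 1) < v" using g by (cases p) auto
    qed
    moreover have "entry \<sigma> (p - 1) \<noteq> v"
      using first[of "p - 1"] p vpos by (cases "p = 1") (auto simp: entry_def)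
    ultimately show ?thesis
      using p unfolding p_def[symmetric] is_descent_iff by auto
  qed
  have "{i. is_double_fall \<sigma> i} = {i. entry \<sigma> (Suc i) < entry \<sigma> i \<and> entry \<sigma> i \<notin> left_free \<sigma>}"
    using fall entry_in_set[of _ \<sigma>] entry_pos[of \<sigma>]
    by (auto simp: is_double_fall_def is_descent_iff dest: le_less_trans[OF le0])
  moreover have "bij_betw (entry \<sigma>) {i. entry \<sigma> (Suc i) < entry \<sigma> i \<and> entry \<sigma> i \<notin> left_free \<sigma>}
      (right_free \<sigma> - left_free \<sigma>)"
    using bij_betw_descents[OF st] by (auto simp: bij_betw_def inj_on_def right_free_def)
  ultimately show ?thesis by (simp add: dfall_def bij_betw_same_card)
qed

lemma des_pos:
  assumes "0 \<notin> set \<sigma>" "\<sigma> \<noteq> []"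
  shows "1 \<le> des \<sigma>"
proof -
  have "is_descent \<sigma> (length \<sigma>)"
    using assms entry_eq_0_iff[OF assms(1), of "Suc (length \<sigma>)"]
    by (metis entry_eq_0_iff gr0I is_descent_iff length_0_conv less_irrefl lessI)
  moreover have "finite {i. is_descent \<sigma> i}"
    by (rule finite_subset[of _ "{..length \<sigma>}"]) (auto simp: is_descent_def)
  ultimately show ?thesis by (auto simp: des_def Suc_le_eq card_gt_0_iff)
qed

text \<open>
  The last occurrence of a value is never a plateau.
\<close>

lemma plat_le:
  assumes pos: "0 \<notin> set \<sigma>"
  shows "plat \<sigma> \<le> length \<sigma> - card (set \<sigma>)"
proof -
  let ?P = "{i. is_plateau \<sigma> i}"
  have P: "?P \<subseteq> {1..length \<sigma>}" by (auto simp: is_plateau_def)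
  have "set \<sigma> \<subseteq> entry \<sigma> ` ({1..length \<sigma>} - ?P)"
  proof
    fix v assume v: "v \<in> set \<sigma>"
    let ?I = "{i. 1 \<le> i \<and> i \<le> length \<sigma> \<and> entry \<sigma> i = v}"
    have "?I \<noteq> {}" "finite ?I" using in_set_entry[OF v] by auto
    hence m: "Max ?I \<in> ?I" and "Suc (Max ?I) \<notin> ?I"
      using Max_in Max_ge by (blast, metis (no_types, lifting) Suc_n_not_le_n)
    hence "entry \<sigma> (Suc (Max ?I)) \<noteq> v"
      using entry_pos[of \<sigma> "Suc (Max ?I)"] v pos by (cases "v = 0") auto
    with m show "v \<in> entry \<sigma> ` ({1..length \<sigma>} - ?P)"
      by (intro image_eqI[of _ _ "Max ?I"]) (auto simp: is_plateau_def)
  qed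
  hence "card (set \<sigma>) \<le> card ({1..length \<sigma>} - ?P)"
    by (meson card_image_le card_mono finite_Diff finite_atLeastAtMost finite_imageI le_trans)
  thus ?thesis
    using P card_mono[OF _ P] by (simp add: plat_def card_Diff_subset finite_subset[OF P])
qed

section \<open>How an inserted block changes the profile\<close>

text \<open>
  The gap \<open>t\<close> disappears and is replaced by the two gaps at the ends of the block and the \<open>k - 1\<close> gaps inside
  it; all other gaps keep their two neighbours.
\<close>

lemma ex_gap_insert_block:
  assumes t: "t \<le> length \<sigma>" and k: "0 < k"
  shows "(\<exists>g. P (entry (insert_block N k t \<sigma>) g) (entry (insert_block N k t \<sigma>) (Suc g))) \<longleftrightarrow>
    P (entry \<sigma> t) N \<or> 1 < k \<and> P N N \<or> P N (entry \<sigma> (Suc t)) \<or>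
    (\<exists>g. g \<noteq> t \<and> P (entry \<sigma> g) (entry \<sigma> (Suc g)))" (is "?L \<longleftrightarrow> ?R")
proof
  assume ?L
  then obtain g where g: "P (entry (insert_block N k t \<sigma>) g) (entry (insert_block N k t \<sigma>) (Suc g))" ..
  consider "g < t" | "g = t" | "t < g" "g < t + k" | "g = t + k" | "t + k < g" by linarith
  thus ?R
  proof cases
    case 5
    hence "g - k \<noteq> t" "Suc g - k = Suc (g - k)" by auto
    thus ?thesis using g 5 by (auto simp: entry_insert_block[OF t])
  qed (use g k in \<open>auto simp: entry_insert_block[OF t] Suc_diff_le\<close>)
next
  assume ?R
  then consider "P (entry \<sigma> t) N" | "1 < k" "P N N" | "P N (entry \<sigma> (Suc t))"
    | g where "g < t" "P (entry \<sigma> g) (entry \<sigma> (Suc g))"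
    | g where "t < g" "P (entry \<sigma> g) (entry \<sigma> (Suc g))"
    by (meson linorder_neqE_nat)
  thus ?L
  proof cases
    case 1 thus ?thesis using k by (intro exI[of _ t]) (auto simp: entry_insert_block[OF t])
  next
    case 2 thus ?thesis by (intro exI[of _ "Suc t"]) (auto simp: entry_insert_block[OF t])
  next
    case 3 thus ?thesis using k by (intro exI[of _ "t + k"]) (auto simp: entry_insert_block[OF t] Suc_diff_le)
  next
    case (4 g) thus ?thesis by (intro exI[of _ g]) (auto simp: entry_insert_block[OF t])
  next
    case (5 g) thus ?thesis using k by (intro exI[of _ "g + k"]) (auto simp: entry_insert_block[OF t] Suc_diff_le)
  qed
qed

lemma left_free_insert_block:
  assumes st: "stirling \<sigma>" and less: "\<forall>v\<in>set \<sigma>. v < N" "0 < N" and t: "t \<le> length \<sigma>" and k: "0 < k"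
  shows "left_free (insert_block N k t \<sigma>) =
    insert N (if entry \<sigma> t < entry \<sigma> (Suc t) then left_free \<sigma> - {entry \<sigma> (Suc t)} else left_free \<sigma>)"
proof -
  have N: "entry \<sigma> g < N" for g by (rule entry_less[OF less])
  have "v \<in> left_free (insert_block N k t \<sigma>) \<longleftrightarrow>
      v = N \<or> (\<exists>g. g \<noteq> t \<and> entry \<sigma> g < v \<and> entry \<sigma> (Suc g) = v)" for v
    unfolding left_free_def mem_Collect_eq
    by (subst ex_gap_insert_block[OF t k, of "\<lambda>a b. a < v \<and> b = v"])
       (use N[of t] N[of "Suc t"] in auto)
  moreover have "(\<exists>g. g \<noteq> t \<and> entry \<sigma> g < v \<and> entry \<sigma> (Suc g) = v) \<longleftrightarrow>
      v \<in> left_free \<sigma> \<and> \<not> (entry \<sigma> t < entry \<sigma> (Suc t) \<and> v = entry \<sigma> (Suc t))" for v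
    using bij_betw_ascents[OF st] by (auto simp: bij_betw_def left_free_def inj_on_def)
  ultimately show ?thesis by auto
qed

lemma right_free_insert_block:
  assumes st: "stirling \<sigma>" and less: "\<forall>v\<in>set \<sigma>. v < N" "0 < N" and t: "t \<le> length \<sigma>" and k: "0 < k"
  shows "right_free (insert_block N k t \<sigma>) =
    insert N (if entry \<sigma> (Suc t) < entry \<sigma> t then right_free \<sigma> - {entry \<sigma> t} else right_free \<sigma>)"
proof -
  have N: "entry \<sigma> g < N" for g by (rule entry_less[OF less])
  have "v \<in> right_free (insert_block N k t \<sigma>) \<longleftrightarrow>
      v = N \<or> (\<exists>g. g \<noteq> t \<and> entry \<sigma> g = v \<and> entry \<sigma> (Suc g) < v)" for v
    unfolding right_free_def mem_Collect_eq
    by (subst ex_gap_insert_block[OF t k, of "\<lambda>a b. a = v \<and> b < v"])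
       (use N[of t] N[of "Suc t"] in auto)
  moreover have "(\<exists>g. g \<noteq> t \<and> entry \<sigma> g = v \<and> entry \<sigma> (Suc g) < v) \<longleftrightarrow>
      v \<in> right_free \<sigma> \<and> \<not> (entry \<sigma> (Suc t) < entry \<sigma> t \<and> v = entry \<sigma> t)" for v
    using bij_betw_descents[OF st] by (auto simp: bij_betw_def right_free_def inj_on_def)
  ultimately show ?thesis by auto
qed

definition profile :: "nat list \<Rightarrow> nat \<times> nat \<times> nat" where
  "profile \<sigma> = (card (left_free \<sigma> \<inter> right_free \<sigma>), card (left_free \<sigma> - right_free \<sigma>),
     card (right_free \<sigma> - left_free \<sigma>))"

lemma profile_insert_block:
  assumes st: "stirling \<sigma>" and less: "\<forall>v\<in>set \<sigma>. v < N" "0 < N" and t: "t \<le> length \<sigma>" and k: "0 < k"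
    and prof: "profile \<sigma> = (e, l, r)"
  shows "profile (insert_block N k t \<sigma>) =
    (if entry \<sigma> t < entry \<sigma> (Suc t)
     then if entry \<sigma> (Suc t) \<in> right_free \<sigma> then (e, l, Suc r) else (Suc e, l - 1, r)
     else if entry \<sigma> (Suc t) < entry \<sigma> t
     then if entry \<sigma> t \<in> left_free \<sigma> then (e, Suc l, r) else (Suc e, l, r - 1)
     else (Suc e, l, r))"
proof -
  let ?L = "left_free \<sigma>" and ?R = "right_free \<sigma>"
  have N: "N \<notin> ?L" "N \<notin> ?R"
    using left_free_subset right_free_subset less by blast+
  have elr: "e = card (?L \<inter> ?R)" "l = card (?L - ?R)" "r = card (?R - ?L)"
    using prof by (auto simp: profile_def)
  have fin: "finite (?L \<inter> ?R)" "finite (?L - ?R)" "finite (?R - ?L)" by auto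
  consider (asc) "entry \<sigma> t < entry \<sigma> (Suc t)" | (des) "entry \<sigma> (Suc t) < entry \<sigma> t"
    | (plat) "entry \<sigma> t = entry \<sigma> (Suc t)" by linarith
  thus ?thesis
  proof cases
    case asc
    let ?v = "entry \<sigma> (Suc t)"
    have v: "?v \<in> ?L" using asc by (auto simp: left_free_def)
    have "left_free (insert_block N k t \<sigma>) = insert N (?L - {?v})"
      "right_free (insert_block N k t \<sigma>) = insert N ?R"
      using left_free_insert_block[OF assms(1-5)] right_free_insert_block[OF assms(1-5)] asc by auto
    moreover have "insert N (?L - {?v}) \<inter> insert N ?R = insert N (?L \<inter> ?R - {?v})"
      "insert N (?L - {?v}) - insert N ?R = (?L - ?R) - {?v}"
      "insert N ?R - insert N (?L - {?v}) = (if ?v \<in> ?R then insert ?v (?R - ?L) else ?R - ?L)"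
      using N v by auto
    ultimately show ?thesis
      using asc v N fin card_gt_0_iff[of "?L \<inter> ?R"] by (auto simp: profile_def elr card_Diff_singleton)
  next
    case des
    let ?v = "entry \<sigma> t"
    have v: "?v \<in> ?R" using des by (auto simp: right_free_def)
    have "left_free (insert_block N k t \<sigma>) = insert N ?L"
      "right_free (insert_block N k t \<sigma>) = insert N (?R - {?v})"
      using left_free_insert_block[OF assms(1-5)] right_free_insert_block[OF assms(1-5)] des by auto
    moreover have "insert N ?L \<inter> insert N (?R - {?v}) = insert N (?L \<inter> ?R - {?v})"
      "insert N (?R - {?v}) - insert N ?L = (?R - ?L) - {?v}"
      "insert N ?L - insert N (?R - {?v}) = (if ?v \<in> ?L then insert ?v (?L - ?R) else ?L - ?R)"
      using N v by auto
    ultimately show ?thesis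
      using des v N fin card_gt_0_iff[of "?L \<inter> ?R"] by (auto simp: profile_def elr card_Diff_singleton)
  next
    case plat
    hence "left_free (insert_block N k t \<sigma>) = insert N ?L"
      "right_free (insert_block N k t \<sigma>) = insert N ?R"
      using left_free_insert_block[OF assms(1-5)] right_free_insert_block[OF assms(1-5)] by auto
    moreover have "insert N ?L \<inter> insert N ?R = insert N (?L \<inter> ?R)"
      "insert N ?L - insert N ?R = ?L - ?R" "insert N ?R - insert N ?L = ?R - ?L"
      using N by auto
    ultimately show ?thesis
      using plat N fin by (simp add: profile_def elr)
  qed
qed

lemma card_free_profile:
  assumes "profile \<sigma> = (e, l, r)"
  shows "card (left_free \<sigma>) = e + l" "card (right_free \<sigma>) = e + r"
  using assms card_Int_Diff[of "left_free \<sigma>" "right_free \<sigma>"] card_Int_Diff[of "right_free \<sigma>" "left_free \<sigma>"]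
  by (auto simp: profile_def Int_commute)

text \<open>
  Each value in \<open>left_free \<sigma>\<close> accounts for one ascent, each value in \<open>right_free \<sigma>\<close> for one descent, and
  the remaining \<open>K + 1 - 2e - l - r\<close> gaps are plateaus. The first two summands come from the values free on
  both sides, which lose either side; the next two from those free on one side, which lose it. The truncated
  predecessors \<open>l - 1\<close> and \<open>r - 1\<close> occur only with a factor that vanishes when they truncate.
\<close>

lemma sum_profile_insert_block:
  fixes f :: "nat \<times> nat \<times> nat \<Rightarrow> nat"
  assumes st: "stirling \<sigma>" and less: "\<forall>v\<in>set \<sigma>. v < N" "0 < N" and k: "0 < k"
    and prof: "profile \<sigma> = (e, l, r)"
  shows "(\<Sum>t\<le>length \<sigma>. f (profile (insert_block N k t \<sigma>))) =
    e * f (e, l, Suc r) + e * f (e, Suc l, r) + l * f (Suc e, l - 1, r) + r * f (Suc e, l, r - 1)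
    + (Suc (length \<sigma>) - (2 * e + (l + r))) * f (Suc e, l, r)"
proof -
  let ?L = "left_free \<sigma>" and ?R = "right_free \<sigma>"
  let ?A = "{g. entry \<sigma> g < entry \<sigma> (Suc g)}" and ?D = "{g. entry \<sigma> (Suc g) < entry \<sigma> g}"
    and ?P = "{g. g \<le> length \<sigma> \<and> entry \<sigma> g = entry \<sigma> (Suc g)}"
  let ?F = "\<lambda>t. f (profile (insert_block N k t \<sigma>))"
  note ins = profile_insert_block[OF st less _ k prof]
  have fin: "finite ?A" "finite ?D" "finite ?P"
    by (auto intro!: finite_subset[of _ "{..length \<sigma>}"] gap_le_length)
  have elr: "e = card (?R \<inter> ?L)" "e = card (?L \<inter> ?R)" "l = card (?L - ?R)" "r = card (?R - ?L)"
    using prof by (auto simp: profile_def Int_commute)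
  have "{..length \<sigma>} = ?A \<union> ?D \<union> ?P"
    by (rule gaps_partition)
  moreover have "sum ?F (?A \<union> ?D \<union> ?P) = sum ?F ?A + sum ?F ?D + sum ?F ?P"
    using fin by (subst sum.union_disjoint; (subst sum.union_disjoint)?; auto)
  moreover have "sum ?F ?A = e * f (e, l, Suc r) + l * f (Suc e, l - 1, r)"
  proof -
    have "sum ?F ?A = (\<Sum>g\<in>?A. if entry \<sigma> (Suc g) \<in> ?R then f (e, l, Suc r) else f (Suc e, l - 1, r))"
      by (rule sum.cong) (auto simp: ins gap_le_length)
    also have "\<dots> = (\<Sum>v\<in>?L. if v \<in> ?R then f (e, l, Suc r) else f (Suc e, l - 1, r))"
      by (rule sum.reindex_bij_betw[OF bij_betw_ascents[OF st]])
    also have "\<dots> = e * f (e, l, Suc r) + l * f (Suc e, l - 1, r)"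
      by (simp add: sum.If_cases elr(2,3) Diff_eq)
    finally show ?thesis .
  qed
  moreover have "sum ?F ?D = e * f (e, Suc l, r) + r * f (Suc e, l, r - 1)"
  proof -
    have "sum ?F ?D = (\<Sum>g\<in>?D. if entry \<sigma> g \<in> ?L then f (e, Suc l, r) else f (Suc e, l, r - 1))"
      by (rule sum.cong) (auto simp: ins gap_le_length)
    also have "\<dots> = (\<Sum>v\<in>?R. if v \<in> ?L then f (e, Suc l, r) else f (Suc e, l, r - 1))"
      by (rule sum.reindex_bij_betw[OF bij_betw_descents[OF st]])
    also have "\<dots> = e * f (e, Suc l, r) + r * f (Suc e, l, r - 1)"
      by (simp add: sum.If_cases elr(1,4) Diff_eq)
    finally show ?thesis .
  qed
  moreover have "sum ?F ?P = card ?P * f (Suc e, l, r)"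
    by (simp add: ins)
  moreover have "card ?P = Suc (length \<sigma>) - (2 * e + (l + r))"
    using card_gaps[OF st] card_free_profile[OF prof] by simp
  ultimately show ?thesis by simp
qed

section \<open>The binomial law for profiles\<close>

definition profile_count :: "nat multiset \<Rightarrow> nat \<Rightarrow> nat \<Rightarrow> nat \<Rightarrow> nat" where
  "profile_count M e l r = card {\<sigma> \<in> stirling_permutations M. profile \<sigma> = (e, l, r)}"

lemma finite_stirling_permutations [simp]: "finite (stirling_permutations M)"
  by (simp add: stirling_permutations_def)

lemma sum_weight_profile:
  fixes w :: nat
  assumes "\<And>e' l' r'. h e' l' r' = (if (e', l', r') = (e, l, r) then w else 0)"
  shows "w * profile_count M e l r =
    (\<Sum>\<sigma>\<in>stirling_permutations M. case profile \<sigma> of (e', l', r') \<Rightarrow> h e' l' r')"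
proof -
  have "(\<Sum>\<sigma>\<in>stirling_permutations M. case profile \<sigma> of (e', l', r') \<Rightarrow> h e' l' r') =
      (\<Sum>\<sigma>\<in>{\<sigma> \<in> stirling_permutations M. profile \<sigma> = (e, l, r)}. w)"
    by (intro sum.mono_neutral_cong_right) (auto simp: assms split: prod.splits)
  thus ?thesis
    unfolding profile_count_def by (simp only: sum_constant of_nat_id mult.commute)
qed

text \<open>
  The recurrence reads off, from the possible changes of a profile under insertion, which profiles lead
  to \<open>(Suc e, l, r)\<close>. An inserted value is free on both sides, so that no profile \<open>(0, l, r)\<close> arises.
\<close>

lemma profile_count_add_max:
  assumes less: "\<forall>v\<in>#M. v < N" "0 < N" and k: "0 < k"
  shows "profile_count (M + replicate_mset k N) 0 l r = 0"
    and "profile_count (M + replicate_mset k N) (Suc e) l r =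
      (case r of 0 \<Rightarrow> 0 | Suc r' \<Rightarrow> Suc e * profile_count M (Suc e) l r')
      + (case l of 0 \<Rightarrow> 0 | Suc l' \<Rightarrow> Suc e * profile_count M (Suc e) l' r)
      + Suc l * profile_count M e (Suc l) r + Suc r * profile_count M e l (Suc r)
      + (Suc (size M) - (2 * e + (l + r))) * profile_count M e l r"
proof -
  let ?Q = "stirling_permutations M"
  have count: "profile_count (M + replicate_mset k N) E l r =
      (\<Sum>\<sigma>\<in>?Q. case profile \<sigma> of (e', l', r') \<Rightarrow>
        e' * of_bool ((e', l', Suc r') = (E, l, r)) + e' * of_bool ((e', Suc l', r') = (E, l, r))
        + l' * of_bool ((Suc e', l' - 1, r') = (E, l, r)) + r' * of_bool ((Suc e', l', r' - 1) = (E, l, r))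
        + (Suc (size M) - (2 * e' + (l' + r'))) * of_bool ((Suc e', l', r') = (E, l, r)))" for E l r
  proof -
    have "profile_count (M + replicate_mset k N) E l r =
        (\<Sum>\<tau>\<in>stirling_permutations (M + replicate_mset k N). of_bool (profile \<tau> = (E, l, r)))"
      by (simp add: profile_count_def Collect_conj_eq)
    also have "\<dots> = (\<Sum>(\<sigma>, t)\<in>?Q \<times> {..size M}. of_bool (profile (insert_block N k t \<sigma>) = (E, l, r)))"
      by (subst sum.reindex_bij_betw[OF stirling_permutations_add_max[OF less(1) k], symmetric])
         (simp add: case_prod_unfold)
    also have "\<dots> = (\<Sum>\<sigma>\<in>?Q. \<Sum>t\<le>size M. of_bool (profile (insert_block N k t \<sigma>) = (E, l, r)))"
      by (rule sum.cartesian_product[symmetric])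
    also have "\<dots> = (\<Sum>\<sigma>\<in>?Q. case profile \<sigma> of (e', l', r') \<Rightarrow>
        e' * of_bool ((e', l', Suc r') = (E, l, r)) + e' * of_bool ((e', Suc l', r') = (E, l, r))
        + l' * of_bool ((Suc e', l' - 1, r') = (E, l, r)) + r' * of_bool ((Suc e', l', r' - 1) = (E, l, r))
        + (Suc (size M) - (2 * e' + (l' + r'))) * of_bool ((Suc e', l', r') = (E, l, r)))"
    proof (rule sum.cong[OF refl])
      fix \<sigma> assume \<sigma>: "\<sigma> \<in> ?Q"
      obtain e' l' r' where prof: "profile \<sigma> = (e', l', r')" by (cases "profile \<sigma>")
      have "\<forall>v\<in>set \<sigma>. v < N" using \<sigma> less by (simp add: stirling_permutationsD)
      from sum_profile_insert_block[OF stirling_permutationsD(1)[OF \<sigma>] this less(2) k prof,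
          of "\<lambda>s. of_bool (s = (E, l, r))"]
      show "(\<Sum>t\<le>size M. of_bool (profile (insert_block N k t \<sigma>) = (E, l, r))) =
        (case profile \<sigma> of (e', l', r') \<Rightarrow>
        e' * of_bool ((e', l', Suc r') = (E, l, r)) + e' * of_bool ((e', Suc l', r') = (E, l, r))
        + l' * of_bool ((Suc e', l' - 1, r') = (E, l, r)) + r' * of_bool ((Suc e', l', r' - 1) = (E, l, r))
        + (Suc (size M) - (2 * e' + (l' + r'))) * of_bool ((Suc e', l', r') = (E, l, r)))"
        by (simp only: prof prod.case stirling_permutationsD(2)[OF \<sigma>])
    qed
    finally show ?thesis .
  qed
  show "profile_count (M + replicate_mset k N) 0 l r = 0"
    unfolding count by (intro sum.neutral) (auto split: prod.splits)
  have "(case r of 0 \<Rightarrow> 0 | Suc r' \<Rightarrow> Suc e * profile_count M (Suc e) l r') =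
      (\<Sum>\<sigma>\<in>?Q. case profile \<sigma> of (e', l', r') \<Rightarrow> e' * of_bool ((e', l', Suc r') = (Suc e, l, r)))"
  proof (cases r)
    case 0
    thus ?thesis by (auto intro!: sum.neutral[symmetric] split: prod.splits)
  next
    case (Suc m)
    show ?thesis unfolding Suc nat.case by (rule sum_weight_profile) auto
  qed
  moreover have "(case l of 0 \<Rightarrow> 0 | Suc l' \<Rightarrow> Suc e * profile_count M (Suc e) l' r) =
      (\<Sum>\<sigma>\<in>?Q. case profile \<sigma> of (e', l', r') \<Rightarrow> e' * of_bool ((e', Suc l', r') = (Suc e, l, r)))"
  proof (cases l)
    case 0
    thus ?thesis by (auto intro!: sum.neutral[symmetric] split: prod.splits)
  next
    case (Suc m)
    show ?thesis unfolding Suc nat.case by (rule sum_weight_profile) auto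
  qed
  moreover have "Suc l * profile_count M e (Suc l) r =
      (\<Sum>\<sigma>\<in>?Q. case profile \<sigma> of (e', l', r') \<Rightarrow> l' * of_bool ((Suc e', l' - 1, r') = (Suc e, l, r)))"
    by (rule sum_weight_profile) auto
  moreover have "Suc r * profile_count M e l (Suc r) =
      (\<Sum>\<sigma>\<in>?Q. case profile \<sigma> of (e', l', r') \<Rightarrow> r' * of_bool ((Suc e', l', r' - 1) = (Suc e, l, r)))"
    by (rule sum_weight_profile) auto
  moreover have "(Suc (size M) - (2 * e + (l + r))) * profile_count M e l r =
      (\<Sum>\<sigma>\<in>?Q. case profile \<sigma> of (e', l', r') \<Rightarrow>
        (Suc (size M) - (2 * e' + (l' + r'))) * of_bool ((Suc e', l', r') = (Suc e, l, r)))"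
    by (rule sum_weight_profile) auto
  ultimately show "profile_count (M + replicate_mset k N) (Suc e) l r =
      (case r of 0 \<Rightarrow> 0 | Suc r' \<Rightarrow> Suc e * profile_count M (Suc e) l r')
      + (case l of 0 \<Rightarrow> 0 | Suc l' \<Rightarrow> Suc e * profile_count M (Suc e) l' r)
      + Suc l * profile_count M e (Suc l) r + Suc r * profile_count M e l (Suc r)
      + (Suc (size M) - (2 * e + (l + r))) * profile_count M e l r"
    unfolding count by (simp only: sum.distrib case_prod_unfold)
qed

text \<open>
  The right-hand side of the recurrence for profile counts is compatible with the binomial law: the first
  two terms combine by Pascal's rule, and the next two are turned into multiples of \<open>l + r choose r\<close> by
  absorption. The weight of the last term depends on \<open>l + r\<close> only.
\<close>

lemma binomial_recurrence:
  fixes c :: "nat \<Rightarrow> nat \<Rightarrow> nat \<Rightarrow> nat" and p :: "nat \<Rightarrow> nat \<Rightarrow> nat"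
  assumes c: "\<And>e l r. c e l r = (l + r choose r) * c e (l + r) 0"
  defines "c' \<equiv> \<lambda>e l r. (case r of 0 \<Rightarrow> 0 | Suc r' \<Rightarrow> Suc e * c (Suc e) l r')
      + (case l of 0 \<Rightarrow> 0 | Suc l' \<Rightarrow> Suc e * c (Suc e) l' r)
      + Suc l * c e (Suc l) r + Suc r * c e l (Suc r) + p e (l + r) * c e l r"
  shows "c' e l r = (l + r choose r) * c' e (l + r) 0"
proof -
  have 1: "(case r of 0 \<Rightarrow> 0 | Suc r' \<Rightarrow> Suc e * c (Suc e) l r')
      + (case l of 0 \<Rightarrow> 0 | Suc l' \<Rightarrow> Suc e * c (Suc e) l' r)
    = (l + r choose r) * (case l + r of 0 \<Rightarrow> 0 | Suc s \<Rightarrow> Suc e * c (Suc e) s 0)"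
  proof (cases r; cases l)
    fix r' l' assume "r = Suc r'" "l = Suc l'"
    thus ?thesis
      using c[of "Suc e" "Suc l'" r'] c[of "Suc e" l' "Suc r'"]
      by (simp add: algebra_simps)
  qed (use c[of "Suc e" 0 "r - 1"] in auto)
  have 2: "Suc l * c e (Suc l) r = (l + r choose r) * (Suc (l + r) * c e (Suc (l + r)) 0)"
    using c[of e "Suc l" r] binomial_absorb_comp[of "Suc (l + r)" r] by (simp add: Suc_diff_le) (metis mult.assoc mult.commute mult_Suc)
  have 3: "Suc r * c e l (Suc r) = (l + r choose r) * (Suc (l + r) * c e (Suc (l + r)) 0)"
    using c[of e l "Suc r"] Suc_times_binomial_eq[of "l + r" r]
    by (metis add_Suc_right mult.assoc mult.commute)
  have 4: "c e (l + r) (Suc 0) = Suc (l + r) * c e (Suc (l + r)) 0"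
    using c[of e "l + r" "Suc 0"] by simp
  have "c' e l r = (l + r choose r) * (case l + r of 0 \<Rightarrow> 0 | Suc s \<Rightarrow> Suc e * c (Suc e) s 0)
      + (l + r choose r) * (Suc (l + r) * c e (Suc (l + r)) 0)
      + (l + r choose r) * (Suc (l + r) * c e (Suc (l + r)) 0)
      + p e (l + r) * ((l + r choose r) * c e (l + r) 0)"
    unfolding c'_def 1 2 3 using c[of e l r] by simp
  also have "\<dots> = (l + r choose r) * c' e (l + r) 0"
    unfolding c'_def using 4 by (simp add: algebra_simps)
  finally show ?thesis .
qed

text \<open>
  The induction removes all copies of the largest value, so that the recurrence for profile counts
  applies.
\<close>

lemma profile_count_binomial:
  assumes "0 \<notin># M"
  shows "profile_count M e l r = (l + r choose r) * profile_count M e (l + r) 0"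
proof -
  have "\<forall>M e l r. set_mset M = V \<longrightarrow> 0 \<notin> V \<longrightarrow>
      profile_count M e l r = (l + r choose r) * profile_count M e (l + r) 0" if "finite V" for V
    using that
  proof (induction V rule: finite_linorder_max_induct)
    case empty
    have "stirling_permutations {#} = {[]}"
      by (auto simp: stirling_permutations_def permutations_of_multiset_def stirling_def)
    moreover have "left_free [] = {}" "right_free [] = {}"
      using left_free_subset[of "[]"] right_free_subset[of "[]"] by auto
    ultimately have "profile_count {#} e l r = (if (e, l, r) = (0, 0, 0) then 1 else 0)" for e l r
      by (simp add: profile_count_def profile_def Collect_conv_if cong: conj_cong)
    thus ?case by simp
  next
    case (insert N V)
    show ?case
    proof (intro allI impI)
      fix M e l r assume M: "set_mset M = insert N V" and pos: "0 \<notin> insert N V"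
      define M' where "M' = filter_mset (\<lambda>v. v \<noteq> N) M"
      have "M = M' + replicate_mset (count M N) N"
        unfolding M'_def by (metis (no_types) add.commute filter_eq_replicate_mset multiset_partition)
      moreover have "set_mset M' = V"
        using M insert.hyps(2) by (auto simp: M'_def)
      moreover have "0 < count M N" using M by auto
      ultimately obtain k where k: "M = M' + replicate_mset k N" "0 < k" and V: "set_mset M' = V" by metis
      have less: "\<forall>v\<in>#M'. v < N" "0 < N" using insert.hyps(2) V pos by auto
      have IH: "profile_count M' e l r = (l + r choose r) * profile_count M' e (l + r) 0" for e l r
        using insert.IH V pos by blast
      show "profile_count M e l r = (l + r choose r) * profile_count M e (l + r) 0"
      proof (cases e)
        case 0
        thus ?thesis using profile_count_add_max(1)[OF less k(2)] k(1) by simp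
      next
        case (Suc e')
        show ?thesis
          unfolding Suc k(1) profile_count_add_max(2)[OF less k(2)] add_0_right
          using binomial_recurrence[where c = "profile_count M'", OF IH, where p = "\<lambda>e s. Suc (size M') - (2 * e + s)"] by simp
      qed
    qed
  qed
  thus ?thesis using assms by blast
qed

section \<open>The expansion of the Eulerian polynomial\<close>

text \<open>
  This is the binomial law in the form of a summation rule: a permutation in which no value is free on the
  right only represents all profiles with the same \<open>e\<close> and the same \<open>l + r\<close>.
\<close>

lemma sum_profile_right_free_subset:
  fixes f :: "nat \<Rightarrow> nat \<Rightarrow> nat \<Rightarrow> 'a::comm_semiring_1"
  assumes pos: "0 \<notin># M"
  shows "(\<Sum>\<sigma>\<in>stirling_permutations M. case profile \<sigma> of (e, l, r) \<Rightarrow> f e l r) =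
    (\<Sum>\<sigma> | \<sigma> \<in> stirling_permutations M \<and> right_free \<sigma> \<subseteq> left_free \<sigma>.
      case profile \<sigma> of (e, s, _) \<Rightarrow> \<Sum>r\<le>s. of_nat (s choose r) * f e (s - r) r)"
proof -
  let ?Q = "stirling_permutations M" and ?g = "\<lambda>\<sigma>. case profile \<sigma> of (e, l, r) \<Rightarrow> (e, l + r)"
  let ?h = "\<lambda>\<sigma>. case profile \<sigma> of (e, l, r) \<Rightarrow> ((e, l + r), r)"
  \<comment> \<open>Permutations are grouped by \<open>(e, l + r)\<close> first, and by \<open>r\<close> second.\<close>
  define S where "S = ?g ` ?Q"
  have S: "finite S" by (simp add: S_def)
  have image: "?h ` ?Q \<subseteq> Sigma S (\<lambda>y. {..snd y})"
  proof (rule image_subsetI)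
    fix \<sigma> assume "\<sigma> \<in> ?Q"
    thus "?h \<sigma> \<in> Sigma S (\<lambda>y. {..snd y})"
      unfolding S_def by (cases "profile \<sigma>") (auto intro: image_eqI[of _ _ \<sigma>])
  qed
  define F where "F = (\<lambda>y. \<Sum>\<sigma> | \<sigma> \<in> ?Q \<and> ?h \<sigma> = y. case profile \<sigma> of (e, l, r) \<Rightarrow> f e l r)"
  have "(\<Sum>\<sigma>\<in>?Q. case profile \<sigma> of (e, l, r) \<Rightarrow> f e l r) = (\<Sum>y\<in>Sigma S (\<lambda>y. {..snd y}). F y)"
    unfolding F_def by (rule sum.group[symmetric]) (use S image in auto)
  also have "\<dots> = (\<Sum>y\<in>S. \<Sum>r\<le>snd y. F (y, r))"
    using S by (simp add: sum.Sigma)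
  also have "\<dots> = (\<Sum>y\<in>S. \<Sum>\<sigma> | \<sigma> \<in> {\<sigma> \<in> ?Q. right_free \<sigma> \<subseteq> left_free \<sigma>} \<and> ?g \<sigma> = y.
      case profile \<sigma> of (e, s, _) \<Rightarrow> \<Sum>r\<le>s. of_nat (s choose r) * f e (s - r) r)"
  proof (rule sum.cong[OF refl])
    fix y :: "nat \<times> nat" assume "y \<in> S"
    obtain e s where y: "y = (e, s)" by (cases y)
    have "F (y, r) = of_nat (profile_count M e s 0) * (of_nat (s choose r) * f e (s - r) r)" if r: "r \<le> s" for r
    proof -
      have eq: "{\<sigma> \<in> ?Q. ?h \<sigma> = (y, r)} = {\<sigma> \<in> ?Q. profile \<sigma> = (e, s - r, r)}"
        by (intro Collect_cong) (use r in \<open>auto simp: y case_prod_unfold prod_eq_iff\<close>)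
      have "F (y, r) = of_nat (profile_count M e (s - r) r) * f e (s - r) r"
        unfolding F_def eq profile_count_def by (subst sum.cong[OF refl, of _ _ "\<lambda>_. f e (s - r) r"]) auto
      thus ?thesis
        using profile_count_binomial[OF pos, of e "s - r" r] r by (simp add: ac_simps)
    qed
    hence "(\<Sum>r\<le>snd y. F (y, r))
        = of_nat (profile_count M e s 0) * (\<Sum>r\<le>s. of_nat (s choose r) * f e (s - r) r)"
      by (simp add: y sum_distrib_left)
    moreover have "{\<sigma> \<in> {\<sigma> \<in> ?Q. right_free \<sigma> \<subseteq> left_free \<sigma>}. ?g \<sigma> = y} = {\<sigma> \<in> ?Q. profile \<sigma> = (e, s, 0)}"
      by (auto simp: y profile_def)
    hence "(\<Sum>\<sigma> | \<sigma> \<in> {\<sigma> \<in> ?Q. right_free \<sigma> \<subseteq> left_free \<sigma>} \<and> ?g \<sigma> = y.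
        case profile \<sigma> of (e, s, _) \<Rightarrow> \<Sum>r\<le>s. of_nat (s choose r) * f e (s - r) r)
        = of_nat (profile_count M e s 0) * (\<Sum>r\<le>s. of_nat (s choose r) * f e (s - r) r)"
      unfolding profile_count_def
      by (subst sum.cong[OF _ refl, of _ "{\<sigma> \<in> ?Q. profile \<sigma> = (e, s, 0)}"]) simp_all
    ultimately show "(\<Sum>r\<le>snd y. F (y, r))
      = (\<Sum>\<sigma> | \<sigma> \<in> {\<sigma> \<in> ?Q. right_free \<sigma> \<subseteq> left_free \<sigma>} \<and> ?g \<sigma> = y.
        case profile \<sigma> of (e, s, _) \<Rightarrow> \<Sum>r\<le>s. of_nat (s choose r) * f e (s - r) r)"
      by simp
  qed
  also have "\<dots> = (\<Sum>\<sigma> | \<sigma> \<in> ?Q \<and> right_free \<sigma> \<subseteq> left_free \<sigma>.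
      case profile \<sigma> of (e, s, _) \<Rightarrow> \<Sum>r\<le>s. of_nat (s choose r) * f e (s - r) r)"
    by (rule sum.group) (use S in \<open>auto simp: S_def\<close>)
  finally show ?thesis .
qed

lemma statistics_profile:
  assumes \<sigma>: "\<sigma> \<in> stirling_permutations M" and M: "0 \<notin># M" "M \<noteq> {#}"
    and prof: "profile \<sigma> = (e, l, r)"
  shows "asc \<sigma> = e + l" "des \<sigma> = e + r" "dfall \<sigma> = r" "plat \<sigma> = Suc (size M) - (2 * e + (l + r))"
    "2 * e + (l + r) + plat \<sigma> = Suc (size M)"
proof -
  note st = stirling_permutationsD[OF \<sigma>]
  have ne: "\<sigma> \<noteq> []" and pos: "0 \<notin> set \<sigma>" using st M by auto
  show asc: "asc \<sigma> = e + l" and des: "des \<sigma> = e + r" and "dfall \<sigma> = r"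
    using asc_eq_card_left_free[OF st(1)] des_eq_card_right_free[OF st(1)] card_free_profile[OF prof]
      dfall_eq_card[OF st(1) pos] prof by (auto simp: profile_def)
  show "plat \<sigma> = Suc (size M) - (2 * e + (l + r))" "2 * e + (l + r) + plat \<sigma> = Suc (size M)"
    using asc_des_plat[OF st(1) pos ne] asc des st(2) by auto
qed

text \<open>
  Apply the summation rule to \<open>(xy)\<^sup>e x\<^sup>l y\<^sup>r z\<^sup>p\<close>; the exponent \<open>p\<close> depends on \<open>e\<close> and \<open>l + r\<close> only, so
  only \<open>x\<^sup>l y\<^sup>r\<close> varies in the inner sum, and the binomial theorem turns it into \<open>(x + y)\<^bsup>l+r\<^esup>\<close>.
\<close>

lemma eulerian_poly_expansion:
  assumes M: "0 \<notin># M" "M \<noteq> {#}"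
  shows "eulerian_poly M = (\<Sum>\<sigma> | \<sigma> \<in> stirling_permutations M \<and> dfall \<sigma> = 0.
    var_z ^ plat \<sigma> * ((var_x * var_y) ^ des \<sigma> * (var_x + var_y) ^ (size M + 1 - plat \<sigma> - 2 * des \<sigma>)))"
proof -
  let ?Q = "stirling_permutations M" and ?p = "\<lambda>e s. Suc (size M) - (2 * e + s)"
  have "eulerian_poly M = (\<Sum>\<sigma>\<in>?Q. case profile \<sigma> of (e, l, r) \<Rightarrow>
      var_x ^ (e + l) * var_y ^ (e + r) * var_z ^ ?p e (l + r))"
    unfolding eulerian_poly_def
    by (rule sum.cong[OF refl]) (auto simp: statistics_profile[OF _ M] split: prod.splits)
  also have "\<dots> = (\<Sum>\<sigma> | \<sigma> \<in> ?Q \<and> right_free \<sigma> \<subseteq> left_free \<sigma>. case profile \<sigma> of (e, s, _) \<Rightarrow>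
      \<Sum>r\<le>s. of_nat (s choose r) * (var_x ^ (e + (s - r)) * var_y ^ (e + r) * var_z ^ ?p e (s - r + r)))"
    by (rule sum_profile_right_free_subset[OF M(1)])
  also have "\<dots> = (\<Sum>\<sigma> | \<sigma> \<in> ?Q \<and> dfall \<sigma> = 0.
    var_z ^ plat \<sigma> * ((var_x * var_y) ^ des \<sigma> * (var_x + var_y) ^ (size M + 1 - plat \<sigma> - 2 * des \<sigma>)))"
  proof (rule sum.cong)
    show "{\<sigma> \<in> ?Q. right_free \<sigma> \<subseteq> left_free \<sigma>} = {\<sigma> \<in> ?Q. dfall \<sigma> = 0}"
      using dfall_eq_card[OF stirling_permutationsD(1)] M(1) by (auto simp: stirling_permutationsD(3))
  next
    fix \<sigma> assume "\<sigma> \<in> {\<sigma> \<in> ?Q. dfall \<sigma> = 0}"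
    hence \<sigma>: "\<sigma> \<in> ?Q" "dfall \<sigma> = 0" by auto
    obtain e s where prof: "profile \<sigma> = (e, s, 0)"
      using statistics_profile(3)[OF \<sigma>(1) M] \<sigma>(2) by (cases "profile \<sigma>") auto
    note stat = statistics_profile[OF \<sigma>(1) M prof]
    have exponents: "des \<sigma> = e" "size M + 1 - plat \<sigma> - 2 * e = s" "?p e s = plat \<sigma>"
      using stat by auto
    have "(\<Sum>r\<le>s. of_nat (s choose r) * (var_x ^ (e + (s - r)) * var_y ^ (e + r) * var_z ^ ?p e (s - r + r)))
        = (\<Sum>r\<le>s. var_z ^ plat \<sigma> * ((var_x * var_y) ^ e *
            (of_nat (s choose r) * var_y ^ r * var_x ^ (s - r))))"
    proof (rule sum.cong[OF refl])
      fix r assume "r \<in> {..s}"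
      hence "s - r + r = s" by simp
      thus "of_nat (s choose r) * (var_x ^ (e + (s - r)) * var_y ^ (e + r) * var_z ^ ?p e (s - r + r)) =
          var_z ^ plat \<sigma> * ((var_x * var_y) ^ e * (of_nat (s choose r) * var_y ^ r * var_x ^ (s - r)))"
        by (simp only: exponents(3) power_add power_mult_distrib, simp only: mult_ac)
    qed
    also have "\<dots> = var_z ^ plat \<sigma> * ((var_x * var_y) ^ e * (var_x + var_y) ^ s)"
      by (simp add: add.commute[of var_x] binomial_ring sum_distrib_left)
    finally show "(case profile \<sigma> of (e, s, _) \<Rightarrow>
        \<Sum>r\<le>s. of_nat (s choose r) * (var_x ^ (e + (s - r)) * var_y ^ (e + r) * var_z ^ ?p e (s - r + r)))
      = var_z ^ plat \<sigma> * ((var_x * var_y) ^ des \<sigma> * (var_x + var_y) ^ (size M + 1 - plat \<sigma> - 2 * des \<sigma>))"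
      by (simp only: prof prod.case exponents)
  qed
  finally show ?thesis .
qed

text \<open>
  The permutations without double falls only contribute to index pairs of the partial \<open>\<gamma>\<close>-expansion. The
  upper bound on \<open>des\<close> expresses that \<open>des \<sigma> \<le> asc \<sigma>\<close> when every value free on the right is free on
  the left.
\<close>

lemma plat_des_range:
  assumes \<sigma>: "\<sigma> \<in> stirling_permutations M" "dfall \<sigma> = 0" and M: "0 \<notin># M" "M \<noteq> {#}"
  shows "plat \<sigma> \<le> size M - card (set_mset M)" "1 \<le> des \<sigma>" "des \<sigma> \<le> (size M + 1 - plat \<sigma>) div 2"
proof -
  note st = stirling_permutationsD[OF \<sigma>(1)]
  have ne: "\<sigma> \<noteq> []" and pos: "0 \<notin> set \<sigma>" using st M by auto
  obtain e s where prof: "profile \<sigma> = (e, s, 0)"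
    using statistics_profile(3)[OF \<sigma>(1) M] \<sigma>(2) by (cases "profile \<sigma>") auto
  show "plat \<sigma> \<le> size M - card (set_mset M)" using plat_le[OF pos] st by simp
  show "1 \<le> des \<sigma>" by (rule des_pos[OF pos ne])
  show "des \<sigma> \<le> (size M + 1 - plat \<sigma>) div 2"
    using statistics_profile[OF \<sigma>(1) M prof] by auto
qed

lemma partial_gamma_expansion_exists:
  assumes M: "0 \<notin># M" "M \<noteq> {#}"
  shows "is_partial_gamma_expansion M
    (\<lambda>i j. int (card {\<sigma> \<in> stirling_permutations M. plat \<sigma> = i \<and> des \<sigma> = j \<and> dfall \<sigma> = 0}))"
proof -
  let ?K = "size M" and ?n = "card (set_mset M)"
  let ?Q = "{\<sigma> \<in> stirling_permutations M. dfall \<sigma> = 0}"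
  let ?C = "\<lambda>i j. {\<sigma> \<in> stirling_permutations M. plat \<sigma> = i \<and> des \<sigma> = j \<and> dfall \<sigma> = 0}"
  let ?w = "\<lambda>i j. var_z ^ i * ((var_x * var_y) ^ j * (var_x + var_y) ^ (?K + 1 - i - 2 * j))"
  let ?I = "Sigma {0..?K - ?n} (\<lambda>i. {1..(?K + 1 - i) div 2})"
  note range = plat_des_range[OF _ _ M]
  have "eulerian_poly M = (\<Sum>\<sigma>\<in>?Q. ?w (plat \<sigma>) (des \<sigma>))"
    by (rule eulerian_poly_expansion[OF M])
  also have "\<dots> = (\<Sum>y\<in>?I. \<Sum>\<sigma> | \<sigma> \<in> ?Q \<and> (plat \<sigma>, des \<sigma>) = y. ?w (plat \<sigma>) (des \<sigma>))"
    by (rule sum.group[symmetric]) (use range in auto)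
  also have "\<dots> = (\<Sum>(i, j)\<in>?I. of_int (int (card (?C i j))) * ?w i j)"
  proof (rule sum.cong[OF refl], clarify)
    fix i j
    have "{\<sigma> \<in> ?Q. (plat \<sigma>, des \<sigma>) = (i, j)} = ?C i j" by auto
    hence "(\<Sum>\<sigma> | \<sigma> \<in> ?Q \<and> (plat \<sigma>, des \<sigma>) = (i, j). ?w (plat \<sigma>) (des \<sigma>)) = (\<Sum>\<sigma>\<in>?C i j. ?w i j)"
      by (intro sum.cong) auto
    thus "(\<Sum>\<sigma> | \<sigma> \<in> ?Q \<and> (plat \<sigma>, des \<sigma>) = (i, j). ?w (plat \<sigma>) (des \<sigma>))
        = of_int (int (card (?C i j))) * ?w i j"
      by simp
  qed
  also have "\<dots> = (\<Sum>i = 0..?K - ?n. \<Sum>j = 1..(?K + 1 - i) div 2. of_int (int (card (?C i j))) * ?w i j)"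
    by (rule sum.Sigma[symmetric]) auto
  also have "\<dots> = (\<Sum>i = 0..?K - ?n. var_z ^ i * (\<Sum>j = 1..(?K + 1 - i) div 2.
      of_int (int (card (?C i j))) * (var_x * var_y) ^ j * (var_x + var_y) ^ (?K + 1 - i - 2 * j)))"
    by (simp add: sum_distrib_left mult_ac)
  finally have "eulerian_poly M = \<dots>" .
  moreover have "?C i j = {}" if "\<not> (i \<le> ?K - ?n \<and> 1 \<le> j \<and> j \<le> (?K + 1 - i) div 2)" for i j
    using that range by blast
  ultimately show ?thesis
    unfolding is_partial_gamma_expansion_def Let_def by (simp del: One_nat_def)
qed

section \<open>Uniqueness of the coefficients\<close>

text \<open>
  The coefficient of \<open>y\<^sup>j\<close> in \<open>(xy)\<^sup>i (x + y)\<^bsup>m-2i\<^esup>\<close> vanishes for \<open>i > j\<close> and is \<open>x\<^bsup>m-j\<^esup>\<close> for \<open>i = j\<close>.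
  The system of equations for the coefficients is therefore triangular.
\<close>

lemma gamma_basis_independent:
  fixes c c' :: "nat \<Rightarrow> int" and x y :: "int poly poly"
  defines "x \<equiv> [:[:0, 1:]:]" and "y \<equiv> [:0, 1:]"
  assumes eq: "(\<Sum>j = 1..m div 2. of_int (c j) * (x * y) ^ j * (x + y) ^ (m - 2 * j)) =
      (\<Sum>j = 1..m div 2. of_int (c' j) * (x * y) ^ j * (x + y) ^ (m - 2 * j))"
    and "1 \<le> j" "j \<le> m div 2"
  shows "c j = c' j"
  using assms(4,5)
proof (induction j rule: less_induct)
  case (less j)
  let ?X = "[:0, 1:] :: int poly"
  have power: "(x * y) ^ i = monom (?X ^ i) i" for i
  proof -
    have "x * y = monom ?X 1" by (simp add: x_def y_def monom_altdef)
    thus ?thesis by (simp add: monom_power)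
  qed
  have coeff: "coeff (of_int d * (x * y) ^ i * (x + y) ^ s) j =
      (if j < i then 0 else of_int d * ?X ^ i * coeff ((x + y) ^ s) (j - i))" for d i s
    by (simp add: power coeff_monom_mult of_int_poly smult_monom)
  have low: "coeff ((x + y) ^ s) 0 = ?X ^ s" for s
    by (simp add: coeff_0_power x_def y_def)
  have split: "coeff (\<Sum>i = 1..m div 2. of_int (d i) * (x * y) ^ i * (x + y) ^ (m - 2 * i)) j =
      (\<Sum>i\<in>{1..<j}. of_int (d i) * ?X ^ i * coeff ((x + y) ^ (m - 2 * i)) (j - i))
      + of_int (d j) * ?X ^ (m - j)" for d :: "nat \<Rightarrow> int"
  proof -
    have "coeff (\<Sum>i = 1..m div 2. of_int (d i) * (x * y) ^ i * (x + y) ^ (m - 2 * i)) j =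
        (\<Sum>i\<in>{1..j}. of_int (d i) * ?X ^ i * coeff ((x + y) ^ (m - 2 * i)) (j - i))"
      unfolding coeff_sum coeff using less.prems by (intro sum.mono_neutral_cong_right) auto
    also have "{1..j} = insert j {1..<j}" using less.prems by auto
    also have "(\<Sum>i\<in>insert j {1..<j}. of_int (d i) * ?X ^ i * coeff ((x + y) ^ (m - 2 * i)) (j - i)) =
        of_int (d j) * ?X ^ j * ?X ^ (m - 2 * j)
        + (\<Sum>i\<in>{1..<j}. of_int (d i) * ?X ^ i * coeff ((x + y) ^ (m - 2 * i)) (j - i))"
      by (subst sum.insert) (simp_all only: low diff_self_eq_0 finite_atLeastLessThan atLeastLessThan_iff less_irrefl simp_thms)
    also have "of_int (d j) * ?X ^ j * ?X ^ (m - 2 * j) = of_int (d j) * ?X ^ (m - j)"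
    proof -
      have "j + (m - 2 * j) = m - j" using less.prems by auto
      thus ?thesis by (metis mult.assoc power_add)
    qed
    finally show ?thesis by (simp only: add.commute)
  qed
  have "(\<Sum>i\<in>{1..<j}. of_int (c i) * ?X ^ i * coeff ((x + y) ^ (m - 2 * i)) (j - i)) =
      (\<Sum>i\<in>{1..<j}. of_int (c' i) * ?X ^ i * coeff ((x + y) ^ (m - 2 * i)) (j - i))"
    using less by (intro sum.cong) auto
  hence "of_int (c j) * ?X ^ (m - j) = of_int (c' j) * ?X ^ (m - j)"
    using arg_cong[OF eq, of "\<lambda>p. coeff p j"] unfolding split by simp
  moreover have "?X ^ (m - j) \<noteq> 0" by simp
  ultimately show ?case by (metis mult_right_cancel of_int_eq_iff)
qed

lemma partial_gamma_expansion_unique: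
  assumes g: "is_partial_gamma_expansion M g" and h: "is_partial_gamma_expansion M h"
  shows "g = h"
proof (intro ext)
  fix i j
  let ?K = "size M" and ?n = "card (set_mset M)"
  let ?x = "[:[:0, 1:]:] :: int poly poly" and ?y = "[:0, 1:] :: int poly poly"
  let ?G = "\<lambda>g i. \<Sum>j = 1..(?K + 1 - i) div 2. of_int (g i j) * (?x * ?y) ^ j * (?x + ?y) ^ (?K + 1 - i - 2 * j)"
  have inner: "var_z ^ i * (\<Sum>j = 1..(?K + 1 - i) div 2.
      of_int (g i j) * (var_x * var_y) ^ j * (var_x + var_y) ^ (?K + 1 - i - 2 * j)) = monom (?G g i) i"
    for g :: "nat \<Rightarrow> nat \<Rightarrow> int" and i
  proof -
    have const: "of_int a * (var_x * var_y) ^ p * (var_x + var_y) ^ q = [:of_int a * (?x * ?y) ^ p * (?x + ?y) ^ q:]"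
      for a p q
      by (simp only: var_x_def var_y_def of_int_poly mult_pCons_left) (simp add: poly_const_pow mult.commute)
    have const_sum: "(\<Sum>j\<in>A. [:f j:]) = [:\<Sum>j\<in>A. f j:]" for f :: "nat \<Rightarrow> int poly poly" and A
      by (induction A rule: infinite_finite_induct) auto
    show ?thesis unfolding const const_sum var_z_def monom_altdef by (simp add: mult.commute del: One_nat_def)
  qed
  have coeff: "coeff (eulerian_poly M) i = ?G g i" if "is_partial_gamma_expansion M g" "i \<le> ?K - ?n" for g
  proof -
    have "eulerian_poly M = (\<Sum>i = 0..?K - ?n. monom (?G g i) i)"
      using that(1) unfolding is_partial_gamma_expansion_def Let_def inner by blast
    thus ?thesis using that(2) by (simp add: coeff_sum del: One_nat_def)
  qed
  show "g i j = h i j"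
  proof (cases "i \<le> ?K - ?n \<and> 1 \<le> j \<and> j \<le> (?K + 1 - i) div 2")
    case True
    thus ?thesis
      using coeff[OF g] coeff[OF h] by (intro gamma_basis_independent[where m = "?K + 1 - i" and c = "g i" and c' = "h i"]) auto
  next
    case False
    thus ?thesis using g h unfolding is_partial_gamma_expansion_def Let_def by simp
  qed
qed

section \<open>The partial gamma-coefficients\<close>

theorem theorem5p2:
  fixes n K i j :: nat and k :: "nat \<Rightarrow> nat" and M :: "nat multiset"
  assumes "n \<ge> 1"
    and "\<forall>l\<in>{1..n}. k l \<ge> 1"
    and "M = (\<Sum>l = 1..n. replicate_mset (k l) l)"
    and "K = (\<Sum>l = 1..n. k l)"
    and "i \<le> K - n"
    and "1 \<le> j" and "j \<le> (K + 1 - i) div 2"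
  shows "partial_gamma M i j =
    int (card {\<sigma> \<in> stirling_permutations M. plat \<sigma> = i \<and> des \<sigma> = j \<and> dfall \<sigma> = 0})"
proof -
  have k: "k l \<noteq> 0" if "l \<in> {1..n}" for l
    using bspec[OF assms(2) that] by linarith
  have "set_mset M = (\<Union>l\<in>{1..n}. set_mset (replicate_mset (k l) l))"
    unfolding assms(3) by (rule set_mset_sum) simp
  also have "\<dots> = (\<Union>l\<in>{1..n}. {l})"
    by (rule SUP_cong[OF refl]) (simp only: set_mset_replicate_mset_subset k if_False)
  finally have "set_mset M = {1..n}"
    by simp
  hence M: "0 \<notin># M" "M \<noteq> {#}"
    using assms(1) by auto
  have "partial_gamma M =
      (\<lambda>i j. int (card {\<sigma> \<in> stirling_permutations M. plat \<sigma> = i \<and> des \<sigma> = j \<and> dfall \<sigma> = 0}))"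
    unfolding partial_gamma_def
  proof (rule the_equality)
    show "is_partial_gamma_expansion M
        (\<lambda>i j. int (card {\<sigma> \<in> stirling_permutations M. plat \<sigma> = i \<and> des \<sigma> = j \<and> dfall \<sigma> = 0}))"
      by (rule partial_gamma_expansion_exists[OF M])
    thus "g = (\<lambda>i j. int (card {\<sigma> \<in> stirling_permutations M. plat \<sigma> = i \<and> des \<sigma> = j \<and> dfall \<sigma> = 0}))"
      if "is_partial_gamma_expansion M g" for g
      by (rule partial_gamma_expansion_unique[OF that])
  qed
  thus ?thesis by simp
qed

end
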